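(* Let $C_3=[0,1]^3\subset\mathbb{R}^3$ be the unit cube. For arbitrary integer weights $\mathbf{a}=(a,b,c)\in\mathbb{Z}^3$, the refined Ehrhart series of $C_3$ with weights $\mathbf{a}$ is $$E^{\mathbf{a}}_{C_3}(t,q) = \frac{N^{\mathbf{a}}_{C_3}(t,q)}{(1-t)(1-q^at)(1-q^bt)(1-q^ct)(1-q^{a+b}t)(1-q^{a+c}t)(1-q^{b+c}t)(1-q^{a+b+c}t)},$$ where the numerator is $$\begin{aligned} N^{\mathbf{a}}_{C_3}(t,q)={}& 1\\ &-\left(3q^{a+b+c}+q^{2a+b+c}+q^{a+2b+c}+q^{a+b+2c}+q^{a+b}+q^{a+c}+q^{b+c}\right)t^2\\ &+\left(2q^{a+b+c}+2q^{2a+b+c}+2q^{a+2b+c}+2q^{a+b+2c}+2q^{2a+2b+c}+2q^{2a+b+2c}+2q^{a+2b+2c}+2q^{2(a+b+c)}\right)t^3\\ &-\left(q^{2a+2b+c}+q^{2a+b+2c}+q^{a+2b+2c}+3q^{2(a+b+c)}+q^{3a+2b+2c}+q^{2a+3b+2c}+q^{2a+2b+3c}\right)t^4\\ &+q^{3(a+b+c)}t^6. \end{aligned}$$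
   Context: For a $d$-dimensional lattice polytope $\Sigma\subset\mathbb{R}^d$ (a compact convex polytope with vertices in $\mathbb{Z}^d$) and weights $\mathbf{a}=(a_1,\ldots,a_d)\in\mathbb{Z}^d$, let $r\Sigma$ denote the $r$-fold dilation of $\Sigma$ for an integer $r\geq 0$. For integers $k$ put $L^{\mathbf{a}}_\Sigma(r,k)=\#\{\mathbf{v}\in r\Sigma\cap\mathbb{Z}^d : \mathbf{v}\cdot\mathbf{a}=k\}$, where $\cdot$ is the standard inner product. The refined Ehrhart series is $$E^{\mathbf{a}}_\Sigma(t,q)=\sum_{r=0}^\infty\sum_{k\in\mathbb{Z}}L^{\mathbf{a}}_\Sigma(r,k)\,q^kt^r,$$ a formal power series in $t$ with coefficients in the Laurent polynomials $\mathbb{Z}[q,q^{-1}]$. Rational expressions are expanded as power series in $t$ over $\mathbb{Z}[q,q^{-1}]$. *)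

theory Defs
  imports
    "HOL-Analysis.Analysis"
    "HOL-Library.Poly_Mapping"
    "HOL-Computational_Algebra.Formal_Power_Series"
begin

(* The Laurent polynomial ring Z[q, 1/q] is the group ring of the additive group of integers:
   finitely supported functions from exponents to coefficients, with convolution product. *)
type_synonym laurent = "int \<Rightarrow>\<^sub>0 int"

definition qpow :: "int \<Rightarrow> laurent" where
  "qpow k = Poly_Mapping.single k 1"

lemma qpow_0: "qpow 0 = 1"
  by (simp add: qpow_def)

lemma qpow_add: "qpow (k + l) = qpow k * qpow l"
  by (simp add: qpow_def mult_single)

definition lattice_points :: "int ^ 'n \<Rightarrow> (real ^ 'n) set \<Rightarrow> nat \<Rightarrow> int \<Rightarrow> (real ^ 'n) set" where
  "lattice_points a S r k =
     {v \<in> (\<lambda>x. real r *\<^sub>R x) ` S. (\<forall>i. v $ i \<in> \<int>) \<and> v \<bullet> (\<chi> i. real_of_int (a $ i)) = real_of_int k}"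

definition ehrhart_count :: "int ^ 'n \<Rightarrow> (real ^ 'n) set \<Rightarrow> nat \<Rightarrow> int \<Rightarrow> nat" where
  "ehrhart_count a S r k = card (lattice_points a S r k)"

(* Sum_any is the sum over all integers k of a finitely supported family; the support is finite
   for every bounded S (lemma finite_ehrhart_support), in particular for every polytope. *)
definition refined_ehrhart_series :: "int ^ 'n \<Rightarrow> (real ^ 'n) set \<Rightarrow> laurent fps" where
  "refined_ehrhart_series a S =
     Abs_fps (\<lambda>r. Sum_any (\<lambda>k. of_nat (ehrhart_count a S r k) * qpow k))"

lemma finite_lattice_points_bounded:
  fixes T :: "(real ^ 'n) set"
  assumes "bounded T"
  shows "finite {v \<in> T. \<forall>i. v $ i \<in> \<int>}"
proof -
  obtain B where B: "\<And>x. x \<in> T \<Longrightarrow> norm x \<le> B"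
    using assms by (auto simp: bounded_iff)
  have fin: "finite {z :: real. z \<in> \<int> \<and> \<bar>z\<bar> \<le> B}"
    by (rule finite_abs_int_segment)
  have "{v \<in> T. \<forall>i. v $ i \<in> \<int>} \<subseteq>
        (\<lambda>f. \<chi> i. f i) ` (PiE UNIV (\<lambda>_ :: 'n. {z :: real. z \<in> \<int> \<and> \<bar>z\<bar> \<le> B}))"
  proof
    fix v assume v: "v \<in> {v \<in> T. \<forall>i. v $ i \<in> \<int>}"
    have "\<bar>v $ i\<bar> \<le> B" for i
      using B[of v] v component_le_norm_cart[of v i] by auto
    then have "(\<lambda>i. v $ i) \<in> PiE UNIV (\<lambda>_ :: 'n. {z :: real. z \<in> \<int> \<and> \<bar>z\<bar> \<le> B})"
      using v by auto
    then show "v \<in> (\<lambda>f. \<chi> i. f i) ` (PiE UNIV (\<lambda>_ :: 'n. {z :: real. z \<in> \<int> \<and> \<bar>z\<bar> \<le> B}))"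
      by (intro image_eqI[where x = "\<lambda>i. v $ i"]) auto
  qed
  then show ?thesis
    by (rule finite_subset) (intro finite_imageI finite_PiE fin, simp)
qed

lemma finite_ehrhart_support:
  assumes "bounded S"
  shows "finite (lattice_points a S r k)"
    and "finite {k. ehrhart_count a S r k \<noteq> 0}"
proof -
  let ?V = "{v \<in> (\<lambda>x. real r *\<^sub>R x) ` S. \<forall>i. v $ i \<in> \<int>}"
  have fin: "finite ?V"
    by (intro finite_lattice_points_bounded bounded_scaling assms)
  show "finite (lattice_points a S r k)"
    by (rule finite_subset[OF _ fin]) (auto simp: lattice_points_def)
  have "{k. ehrhart_count a S r k \<noteq> 0} \<subseteq>
        (\<lambda>v. \<lfloor>v \<bullet> (\<chi> i. real_of_int (a $ i))\<rfloor>) ` ?V"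
  proof
    fix k assume "k \<in> {k. ehrhart_count a S r k \<noteq> 0}"
    then have "lattice_points a S r k \<noteq> {}"
      by (auto simp: ehrhart_count_def)
    then obtain v where "v \<in> lattice_points a S r k" by blast
    then show "k \<in> (\<lambda>v. \<lfloor>v \<bullet> (\<chi> i. real_of_int (a $ i))\<rfloor>) ` ?V"
      by (intro image_eqI[where x = v]) (auto simp: lattice_points_def)
  qed
  then show "finite {k. ehrhart_count a S r k \<noteq> 0}"
    by (rule finite_subset) (intro finite_imageI fin)
qed

lemma lookup_refined_ehrhart_series:
  assumes "bounded S"
  shows "Poly_Mapping.lookup (fps_nth (refined_ehrhart_series a S) r) k = int (ehrhart_count a S r k)"
proof -
  let ?K = "{k. ehrhart_count a S r k \<noteq> 0}"
  have term_eq: "of_nat n * qpow l = Poly_Mapping.single l (int n)" for n l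
    by (induction n) (simp_all add: qpow_def distrib_right single_add)
  have fin: "finite ?K"
    by (rule finite_ehrhart_support(2)[OF assms])
  have "Sum_any (\<lambda>k. of_nat (ehrhart_count a S r k) * qpow k)
      = (\<Sum>l\<in>?K. Poly_Mapping.single l (int (ehrhart_count a S r l)))"
    unfolding term_eq by (rule Sum_any.expand_superset[OF fin]) (auto intro: ccontr)
  then show ?thesis
    using fin
    by (auto simp: refined_ehrhart_series_def lookup_sum lookup_single when_def sum.delta)
qed

definition unit_cube :: "(real ^ 'n) set" where
  "unit_cube = cbox 0 1"

lemma mem_unit_cube: "x \<in> unit_cube \<longleftrightarrow> (\<forall>i. 0 \<le> x $ i \<and> x $ i \<le> 1)"
  by (simp add: unit_cube_def mem_box_cart)

(* The coefficient ring is not a field, so fps division is not available; P / Q is expanded by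
   multiplying with the power series inverse of Q, for denominators with constant term 1. *)
definition fps_expand :: "laurent fps \<Rightarrow> laurent fps \<Rightarrow> laurent fps" where
  "fps_expand P Q = P * fps_right_inverse Q 1"

lemma fps_expand_iff:
  assumes "fps_nth Q 0 = 1"
  shows "F = fps_expand P Q \<longleftrightarrow> F * Q = P"
proof -
  have inv: "Q * fps_right_inverse Q 1 = 1"
    by (rule fps_right_inverse) (simp add: assms)
  show ?thesis
  proof
    assume "F = fps_expand P Q"
    then have "F * Q = P * (Q * fps_right_inverse Q 1)"
      by (simp add: fps_expand_def ac_simps)
    then show "F * Q = P" by (simp add: inv)
  next
    assume "F * Q = P"
    then have "fps_expand P Q = F * (Q * fps_right_inverse Q 1)"
      by (auto simp: fps_expand_def ac_simps)
    then show "F = fps_expand P Q" by (simp add: inv)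
  qed
qed

definition cube_numerator :: "int \<Rightarrow> int \<Rightarrow> int \<Rightarrow> laurent fps" where
  "cube_numerator a b c =
     1
     - fps_const (3 * qpow (a+b+c) + qpow (2*a+b+c) + qpow (a+2*b+c) + qpow (a+b+2*c)
         + qpow (a+b) + qpow (a+c) + qpow (b+c)) * fps_X ^ 2
     + fps_const (2 * qpow (a+b+c) + 2 * qpow (2*a+b+c) + 2 * qpow (a+2*b+c)
         + 2 * qpow (a+b+2*c) + 2 * qpow (2*a+2*b+c) + 2 * qpow (2*a+b+2*c)
         + 2 * qpow (a+2*b+2*c) + 2 * qpow (2*(a+b+c))) * fps_X ^ 3
     - fps_const (qpow (2*a+2*b+c) + qpow (2*a+b+2*c) + qpow (a+2*b+2*c) + 3 * qpow (2*(a+b+c))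
         + qpow (3*a+2*b+2*c) + qpow (2*a+3*b+2*c) + qpow (2*a+2*b+3*c)) * fps_X ^ 4
     + fps_const (qpow (3*(a+b+c))) * fps_X ^ 6"

definition cube_denominator :: "int \<Rightarrow> int \<Rightarrow> int \<Rightarrow> laurent fps" where
  "cube_denominator a b c =
     (1 - fps_X) * (1 - fps_const (qpow a) * fps_X) * (1 - fps_const (qpow b) * fps_X)
     * (1 - fps_const (qpow c) * fps_X) * (1 - fps_const (qpow (a+b)) * fps_X)
     * (1 - fps_const (qpow (a+c)) * fps_X) * (1 - fps_const (qpow (b+c)) * fps_X)
     * (1 - fps_const (qpow (a+b+c)) * fps_X)"

lemma cube_denominator_nth_0: "fps_nth (cube_denominator a b c) 0 = 1"
  by (simp add: cube_denominator_def fps_mult_nth_0)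

end

theory Submission
  imports Defs
begin

text \<open>
  The lattice points of the \<open>r\<close>-fold dilated cube are the integer points of the box
  \<open>{0..r} \<times> \<dots> \<times> {0..r}\<close>, and the weight \<open>m \<mapsto> q\<^bsup>a \<bullet> m\<^esup>\<close> is multiplicative in the
  coordinates. So the coefficient of \<open>t\<^sup>r\<close> factors as a product of truncated geometric sums
  \<open>h\<^sub>r(x) = 1 + x + \<dots> + x\<^sup>r\<close>, one for each \<open>x = q\<^bsup>a\<^sub>i\<^esup>\<close>
  (lemma \<open>refined_ehrhart_series_unit_cube_nth\<close>).

  It remains to sum \<open>\<Sum>r. h\<^sub>r(x) h\<^sub>r(y) h\<^sub>r(z) t\<^sup>r\<close> for elements \<open>x\<close>, \<open>y\<close>, \<open>z\<close> of a
  commutative ring. The closed form \<open>h\<^sub>r(x) = (x\<^bsup>r+1\<^esup> - 1) / (x - 1)\<close> breaks down at \<open>x = 1\<close>,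
  that is, for weights that vanish. Instead, expand the product
  \<open>h\<^bsub>r+1\<^esub>(x) h\<^bsub>r+1\<^esub>(y) h\<^bsub>r+1\<^esub>(z)\<close> by the recursion \<open>h\<^bsub>r+1\<^esub>(x) = 1 + x h\<^sub>r(x)\<close>.
  This expresses \<open>(1 - xyzt)\<close> times the wanted series by the analogous series for proper
  subsets of \<open>{x, y, z}\<close>. The system is triangular with respect to inclusion of subsets, and
  solving it without any division introduces one factor \<open>1 - (\<Prod>x\<in>T. x) t\<close> of the denominator for
  each \<open>T \<subseteq> {x, y, z}\<close> (lemma \<open>geometric_product_series_3\<close>).
\<close>

section \<open>The refined Ehrhart series as a sum over integer vectors\<close>

text \<open>
  Grouping the integer points of \<open>r S\<close> by the value of the weight gives back the numbers
  \<open>ehrhart_count a S r k\<close>.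
\<close>

lemma refined_ehrhart_series_nth:
  fixes a :: "int ^ 'n" and S :: "(real ^ 'n) set"
  assumes "bounded S"
  shows "fps_nth (refined_ehrhart_series a S) r =
    (\<Sum>m | (\<chi> i. real_of_int (m $ i)) \<in> (\<lambda>x. real r *\<^sub>R x) ` S. qpow (\<Sum>i\<in>UNIV. a $ i * m $ i))"
proof (rule poly_mapping_eqI)
  fix k
  let ?real = "\<lambda>m :: int ^ 'n. \<chi> i. real_of_int (m $ i)"
  let ?T = "(\<lambda>x. real r *\<^sub>R x) ` S"
  let ?w = "\<lambda>m. \<Sum>i\<in>UNIV. a $ i * m $ i"
  have inj: "inj ?real"
    by (auto simp: inj_on_def vec_eq_iff)
  have integral: "?real m $ i \<in> \<int>" for m i
    by simp
  have "finite {v \<in> ?T. \<forall>i. v $ i \<in> \<int>}"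
    by (intro finite_lattice_points_bounded bounded_scaling assms)
  then have "finite (?real ` {m. ?real m \<in> ?T})"
    by (rule rev_finite_subset) (use integral in blast)
  then have fin: "finite {m. ?real m \<in> ?T}"
    by (rule finite_imageD) (rule inj_on_subset[OF inj subset_UNIV])
  have weight: "?real m \<bullet> (\<chi> i. real_of_int (a $ i)) = real_of_int (?w m)" for m
    by (simp add: inner_vec_def mult.commute)
  have "lattice_points a S r k = ?real ` {m. ?real m \<in> ?T \<and> ?w m = k}"
  proof (intro equalityI subsetI)
    fix v assume v: "v \<in> lattice_points a S r k"
    have "?real (\<chi> i. \<lfloor>v $ i\<rfloor>) = v"
      using v by (simp add: lattice_points_def vec_eq_iff)
    moreover from this have "?w (\<chi> i. \<lfloor>v $ i\<rfloor>) = k"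
      using v weight[of "\<chi> i. \<lfloor>v $ i\<rfloor>"] unfolding lattice_points_def
      by (metis (mono_tags, lifting) mem_Collect_eq of_int_eq_iff)
    ultimately show "v \<in> ?real ` {m. ?real m \<in> ?T \<and> ?w m = k}"
      using v unfolding lattice_points_def
      by (intro image_eqI[where x = "\<chi> i. \<lfloor>v $ i\<rfloor>"]) auto
  next
    fix v assume "v \<in> ?real ` {m. ?real m \<in> ?T \<and> ?w m = k}"
    then obtain m where "v = ?real m" "?real m \<in> ?T" "?w m = k" by blast
    then show "v \<in> lattice_points a S r k"
      using weight[of m] by (simp add: lattice_points_def)
  qed
  then have count: "ehrhart_count a S r k = card {m. ?real m \<in> ?T \<and> ?w m = k}"
    unfolding ehrhart_count_def using card_image[OF inj_on_subset[OF inj subset_UNIV]] by simp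
  have "Poly_Mapping.lookup (\<Sum>m | ?real m \<in> ?T. qpow (?w m)) k
      = (\<Sum>m | ?real m \<in> ?T. if ?w m = k then 1 else 0)"
    by (simp add: lookup_sum qpow_def lookup_single when_def eq_commute)
  also have "\<dots> = int (card {m. ?real m \<in> ?T \<and> ?w m = k})"
    using sum.inter_filter[OF fin, of "\<lambda>_. 1 :: int" "\<lambda>m. ?w m = k"] by simp
  finally show "Poly_Mapping.lookup (fps_nth (refined_ehrhart_series a S) r) k =
      Poly_Mapping.lookup (\<Sum>m | ?real m \<in> ?T. qpow (?w m)) k"
    by (simp add: lookup_refined_ehrhart_series[OF assms] count)
qed

section \<open>Lattice points of the dilated cube\<close>

lemma integer_points_dilated_unit_cube:
  "{m :: int ^ 'n. (\<chi> i. real_of_int (m $ i)) \<in> (\<lambda>x. real r *\<^sub>R x) ` unit_cube}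
     = (\<lambda>g. \<chi> i. int (g i)) ` PiE UNIV (\<lambda>_. {..r})"
proof (intro equalityI subsetI)
  fix m :: "int ^ 'n"
  assume "m \<in> {m. (\<chi> i. real_of_int (m $ i)) \<in> (\<lambda>x. real r *\<^sub>R x) ` unit_cube}"
  then obtain x where x: "x \<in> unit_cube" and m: "\<And>i. real_of_int (m $ i) = real r * x $ i"
    by (auto simp: vec_eq_iff)
  have "0 \<le> m $ i \<and> m $ i \<le> int r" for i
  proof -
    have "0 \<le> real r * x $ i" "real r * x $ i \<le> real r"
      using x by (auto simp: mem_unit_cube mult_left_le)
    then show ?thesis
      using m[of i] by linarith
  qed
  then show "m \<in> (\<lambda>g. \<chi> i. int (g i)) ` PiE UNIV (\<lambda>_. {..r})"
    by (intro image_eqI[where x = "\<lambda>i. nat (m $ i)"]) (auto simp: vec_eq_iff nat_le_iff)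
next
  fix m :: "int ^ 'n"
  assume "m \<in> (\<lambda>g. \<chi> i. int (g i)) ` PiE UNIV (\<lambda>_. {..r})"
  then obtain g where "g \<in> PiE UNIV (\<lambda>_. {..r})" and m: "m = (\<chi> i. int (g i))"
    by blast
  then have g: "g i \<le> r" for i
    by auto
  \<comment> \<open>For \<open>r = 0\<close> the preimage below is the origin, because division by zero yields zero.\<close>
  have "(\<chi> i. real (g i) / real r) \<in> unit_cube"
    using g by (auto simp: mem_unit_cube divide_le_eq)
  moreover have "(\<chi> i. real_of_int (m $ i)) = real r *\<^sub>R (\<chi> i. real (g i) / real r)"
    using g by (auto simp: m vec_eq_iff)
  ultimately show "m \<in> {m. (\<chi> i. real_of_int (m $ i)) \<in> (\<lambda>x. real r *\<^sub>R x) ` unit_cube}"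
    by blast
qed

lemma qpow_sum: "qpow (sum f A) = (\<Prod>i\<in>A. qpow (f i))"
  by (induction A rule: infinite_finite_induct) (simp_all add: qpow_0 qpow_add)

lemma qpow_mult_nat: "qpow (k * int n) = qpow k ^ n"
  by (induction n) (simp_all add: qpow_0 qpow_add distrib_left)

text \<open>
  The weight of a point is the product of the weights of its coordinates, so distributivity
  turns the sum over the box into a product of sums over its edges.
\<close>

lemma refined_ehrhart_series_unit_cube_nth:
  fixes a :: "int ^ 'n"
  shows "fps_nth (refined_ehrhart_series a unit_cube) r = (\<Prod>i\<in>UNIV. \<Sum>j\<le>r. qpow (a $ i) ^ j)"
proof -
  have "bounded (unit_cube :: (real ^ 'n) set)"
    by (simp add: unit_cube_def)
  moreover have "inj_on (\<lambda>g. \<chi> i. int (g i)) (PiE UNIV (\<lambda>_ :: 'n. {..r}))"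
    by (auto simp: inj_on_def vec_eq_iff)
  ultimately have "fps_nth (refined_ehrhart_series a unit_cube) r
      = (\<Sum>g\<in>PiE UNIV (\<lambda>_. {..r}). \<Prod>i\<in>UNIV. qpow (a $ i) ^ g i)"
    by (simp add: refined_ehrhart_series_nth integer_points_dilated_unit_cube sum.reindex
        qpow_sum qpow_mult_nat)
  also have "\<dots> = (\<Prod>i\<in>UNIV. \<Sum>j\<le>r. qpow (a $ i) ^ j)"
    by (simp add: prod_sum_PiE)
  finally show ?thesis .
qed

section \<open>Series of products of truncated geometric sums\<close>

lemma geometric_sum_Suc:
  fixes x :: "'a :: comm_ring_1"
  shows "(\<Sum>j\<le>Suc r. x ^ j) = 1 + x * (\<Sum>j\<le>r. x ^ j)"
  by (simp add: sum.atMost_Suc_shift sum_distrib_left del: sum.atMost_Suc)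

lemma Abs_fps_unfold:
  fixes f :: "nat \<Rightarrow> 'a :: comm_ring_1"
  shows "Abs_fps f = fps_const (f 0) + fps_X * Abs_fps (\<lambda>n. f (Suc n))"
  by (rule fps_ext) (simp add: fps_X_mult_nth)

text \<open>
  The series of each subset of \<open>{x, y, z}\<close> satisfies a recursion of this form, where \<open>U\<close> is the
  product over the subset and \<open>B\<close> collects the series of its proper subsets. For \<open>D\<close> one takes a
  common denominator of the latter, so that \<open>B * D\<close> becomes a polynomial.
\<close>

lemma collect_recursion:
  fixes F :: "'a :: comm_ring_1"
  assumes F: "F = 1 + t * (B + U * F)"
  shows "F * (D * (1 - U * t)) = D + t * (B * D)"
proof -
  have "F * (1 - U * t) = F - t * (U * F)"
    by (simp add: algebra_simps)
  also have "\<dots> = 1 + t * B"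
    unfolding diff_eq_eq using F by (rule trans) (simp add: distrib_left add.assoc)
  finally have eq: "F * (1 - U * t) = 1 + t * B" .
  have "F * (D * (1 - U * t)) = F * (1 - U * t) * D"
    by (simp only: mult_ac)
  also have "\<dots> = D + t * (B * D)"
    unfolding eq by (simp add: distrib_right mult.assoc)
  finally show ?thesis .
qed

text \<open>
  In the proof, the series \<open>G\<close>, \<open>G1 x\<close>, \<open>G2 x y\<close>, \<open>F\<close> belong to the subsets \<open>{}\<close>, \<open>{x}\<close>, \<open>{x, y}\<close>,
  \<open>{x, y, z}\<close>, and similarly for the other subsets of one or two elements. The denominator for a subset is divisible by the denominators for its subsets, so
  every substitution in the triangular system can be made after multiplying by the missing
  factors.
\<close>

lemma geometric_product_series_3:
  fixes x y z :: "'a :: comm_ring_1"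
  defines "h \<equiv> \<lambda>u r. \<Sum>j\<le>r. u ^ j"
  defines "X \<equiv> fps_const x" and "Y \<equiv> fps_const y" and "Z \<equiv> fps_const z" and "t \<equiv> fps_X"
  shows "Abs_fps (\<lambda>r. h x r * h y r * h z r)
      * ((1 - t) * (1 - X * t) * (1 - Y * t) * (1 - Z * t)
         * (1 - X * Y * t) * (1 - X * Z * t) * (1 - Y * Z * t) * (1 - X * Y * Z * t))
    = 1
      - (3 * (X * Y * Z) + X^2 * Y * Z + X * Y^2 * Z + X * Y * Z^2 + X * Y + X * Z + Y * Z) * t^2
      + 2 * (X * Y * Z + X^2 * Y * Z + X * Y^2 * Z + X * Y * Z^2
             + X^2 * Y^2 * Z + X^2 * Y * Z^2 + X * Y^2 * Z^2 + X^2 * Y^2 * Z^2) * t^3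
      - (X^2 * Y^2 * Z + X^2 * Y * Z^2 + X * Y^2 * Z^2 + 3 * (X^2 * Y^2 * Z^2)
         + X^3 * Y^2 * Z^2 + X^2 * Y^3 * Z^2 + X^2 * Y^2 * Z^3) * t^4
      + X^3 * Y^3 * Z^3 * t^6"
proof -
  define G where "G = Abs_fps (\<lambda>_. 1 :: 'a)"
  define G1 where "G1 u = Abs_fps (\<lambda>r. h u r)" for u :: 'a
  define G2 where "G2 u v = Abs_fps (\<lambda>r. h u r * h v r)" for u v :: 'a
  define F where "F = Abs_fps (\<lambda>r. h x r * h y r * h z r)"
  have h_0: "h u 0 = 1" for u :: 'a
    by (simp add: h_def)
  have h_Suc: "h u (Suc r) = 1 + u * h u r" for u :: 'a and r
    unfolding h_def by (rule geometric_sum_Suc)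

  have G: "G * (1 - t) = 1"
  proof -
    have "G = 1 + t * (0 + 1 * G)"
      unfolding G_def t_def by (subst Abs_fps_unfold) simp
    from collect_recursion[OF this, of 1] show ?thesis by simp
  qed
  have G1: "G1 u * ((1 - t) * (1 - fps_const u * t)) = 1" for u
  proof -
    have "Abs_fps (\<lambda>r. h u (Suc r)) = G + fps_const u * G1 u"
      by (rule fps_ext) (simp add: h_Suc G_def G1_def)
    then have "G1 u = 1 + t * (G + fps_const u * G1 u)"
      unfolding G1_def t_def by (subst Abs_fps_unfold) (simp add: h_0)
    then have "G1 u * ((1 - t) * (1 - fps_const u * t)) = (1 - t) + t * (G * (1 - t))"
      by (rule collect_recursion)
    then show ?thesis by (simp add: G)
  qed
  have G2: "G2 u v * ((1 - t) * (1 - fps_const u * t) * (1 - fps_const v * t)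
      * (1 - fps_const u * fps_const v * t)) = 1 - fps_const u * fps_const v * t^2" for u v
  proof -
    define U V where "U = fps_const u" and "V = fps_const v"
    have "Abs_fps (\<lambda>r. h u (Suc r) * h v (Suc r)) = G + U * G1 u + V * G1 v + U * V * G2 u v"
      by (rule fps_ext)
        (simp add: h_Suc G_def G1_def G2_def U_def V_def algebra_simps)
    then have "G2 u v = 1 + t * (G + U * G1 u + V * G1 v + U * V * G2 u v)"
      unfolding G2_def t_def by (subst Abs_fps_unfold) (simp add: h_0)
    then have "G2 u v * ((1 - t) * (1 - U * t) * (1 - V * t) * (1 - U * V * t))
      = (1 - t) * (1 - U * t) * (1 - V * t)
        + t * ((G + U * G1 u + V * G1 v) * ((1 - t) * (1 - U * t) * (1 - V * t)))"
      by (rule collect_recursion)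
    also have "\<dots> = (1 - t) * (1 - U * t) * (1 - V * t)
        + t * (G * (1 - t) * ((1 - U * t) * (1 - V * t))
          + U * (G1 u * ((1 - t) * (1 - U * t))) * (1 - V * t)
          + V * (G1 v * ((1 - t) * (1 - V * t))) * (1 - U * t))"
      by (simp only: distrib_left distrib_right mult_1_left mult_ac)
    also have "\<dots> = (1 - t) * (1 - U * t) * (1 - V * t)
        + t * ((1 - U * t) * (1 - V * t) + U * (1 - V * t) + V * (1 - U * t))"
      by (simp only: G G1[of u, folded U_def] G1[of v, folded V_def] mult_1_left mult_1_right)
    also have "\<dots> = 1 - U * V * t^2"
      by (simp add: algebra_simps power2_eq_square)
    finally show ?thesis
      unfolding U_def V_def .
  qed
  have rec: "F = 1 + t * (G + X * G1 x + Y * G1 y + Z * G1 z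
      + X * Y * G2 x y + X * Z * G2 x z + Y * Z * G2 y z + X * Y * Z * F)"
  proof -
    have "Abs_fps (\<lambda>r. h x (Suc r) * h y (Suc r) * h z (Suc r))
      = G + X * G1 x + Y * G1 y + Z * G1 z
      + X * Y * G2 x y + X * Z * G2 x z + Y * Z * G2 y z + X * Y * Z * F"
      by (rule fps_ext)
        (simp add: h_Suc G_def G1_def G2_def F_def X_def Y_def Z_def algebra_simps)
    then show ?thesis
      unfolding F_def t_def by (subst Abs_fps_unfold) (simp add: h_0)
  qed
  note G1x = G1[of x, folded X_def] and G1y = G1[of y, folded Y_def] and G1z = G1[of z, folded Z_def]
  note G2xy = G2[of x y, folded X_def Y_def] and G2xz = G2[of x z, folded X_def Z_def]
    and G2yz = G2[of y z, folded Y_def Z_def]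
  let ?A = "1 - X * t" and ?B = "1 - Y * t" and ?C = "1 - Z * t"
  let ?AB = "1 - X * Y * t" and ?AC = "1 - X * Z * t" and ?BC = "1 - Y * Z * t"
  from rec have "F * ((1 - t) * ?A * ?B * ?C * ?AB * ?AC * ?BC * (1 - X * Y * Z * t))
    = (1 - t) * ?A * ?B * ?C * ?AB * ?AC * ?BC
      + t * ((G + X * G1 x + Y * G1 y + Z * G1 z
        + X * Y * G2 x y + X * Z * G2 x z + Y * Z * G2 y z)
        * ((1 - t) * ?A * ?B * ?C * ?AB * ?AC * ?BC))"
    by (rule collect_recursion)
  \<comment> \<open>In each summand, the part of the common denominator that belongs to its series is grouped with
    that series.\<close>
  also have "\<dots> = (1 - t) * ?A * ?B * ?C * ?AB * ?AC * ?BC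
      + t * (G * (1 - t) * (?A * ?B * ?C * ?AB * ?AC * ?BC)
        + X * (G1 x * ((1 - t) * ?A)) * (?B * ?C * ?AB * ?AC * ?BC)
        + Y * (G1 y * ((1 - t) * ?B)) * (?A * ?C * ?AB * ?AC * ?BC)
        + Z * (G1 z * ((1 - t) * ?C)) * (?A * ?B * ?AB * ?AC * ?BC)
        + X * Y * (G2 x y * ((1 - t) * ?A * ?B * ?AB)) * (?C * ?AC * ?BC)
        + X * Z * (G2 x z * ((1 - t) * ?A * ?C * ?AC)) * (?B * ?AB * ?BC)
        + Y * Z * (G2 y z * ((1 - t) * ?B * ?C * ?BC)) * (?A * ?AB * ?AC))"
    by (simp only: distrib_left distrib_right mult_1_left mult_ac)
  also have "\<dots> = (1 - t) * ?A * ?B * ?C * ?AB * ?AC * ?BC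
      + t * (?A * ?B * ?C * ?AB * ?AC * ?BC
        + X * (?B * ?C * ?AB * ?AC * ?BC)
        + Y * (?A * ?C * ?AB * ?AC * ?BC)
        + Z * (?A * ?B * ?AB * ?AC * ?BC)
        + X * Y * (1 - X * Y * t^2) * (?C * ?AC * ?BC)
        + X * Z * (1 - X * Z * t^2) * (?B * ?AB * ?BC)
        + Y * Z * (1 - Y * Z * t^2) * (?A * ?AB * ?AC))"
    by (simp only: G G1x G1y G1z G2xy G2xz G2yz mult_1_left mult_1_right)
  also have "\<dots> = 1
      - (3 * (X * Y * Z) + X^2 * Y * Z + X * Y^2 * Z + X * Y * Z^2 + X * Y + X * Z + Y * Z) * t^2
      + 2 * (X * Y * Z + X^2 * Y * Z + X * Y^2 * Z + X * Y * Z^2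
             + X^2 * Y^2 * Z + X^2 * Y * Z^2 + X * Y^2 * Z^2 + X^2 * Y^2 * Z^2) * t^3
      - (X^2 * Y^2 * Z + X^2 * Y * Z^2 + X * Y^2 * Z^2 + 3 * (X^2 * Y^2 * Z^2)
         + X^3 * Y^2 * Z^2 + X^2 * Y^3 * Z^2 + X^2 * Y^2 * Z^3) * t^4
      + X^3 * Y^3 * Z^3 * t^6"
    by (simp add: algebra_simps eval_nat_numeral)
  finally show ?thesis unfolding F_def .
qed

section \<open>The cube with arbitrary weights\<close>

text \<open>
  Since \<open>qpow\<close> turns sums into products, numerator and denominator are polynomials in the three
  variables \<open>q\<^sup>a\<close>, \<open>q\<^sup>b\<close>, \<open>q\<^sup>c\<close>.
\<close>

lemma cube_denominator_eq:
  fixes a b c :: int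
  defines "X \<equiv> fps_const (qpow a)" and "Y \<equiv> fps_const (qpow b)" and "Z \<equiv> fps_const (qpow c)"
  shows "cube_denominator a b c = (1 - fps_X) * (1 - X * fps_X) * (1 - Y * fps_X) * (1 - Z * fps_X)
         * (1 - X * Y * fps_X) * (1 - X * Z * fps_X) * (1 - Y * Z * fps_X)
         * (1 - X * Y * Z * fps_X)"
  by (simp add: cube_denominator_def X_def Y_def Z_def qpow_add)

lemma cube_numerator_eq:
  fixes a b c :: int
  defines "X \<equiv> fps_const (qpow a)" and "Y \<equiv> fps_const (qpow b)" and "Z \<equiv> fps_const (qpow c)"
  shows "cube_numerator a b c = 1
      - (3 * (X * Y * Z) + X^2 * Y * Z + X * Y^2 * Z + X * Y * Z^2 + X * Y + X * Z + Y * Z) * fps_X^2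
      + 2 * (X * Y * Z + X^2 * Y * Z + X * Y^2 * Z + X * Y * Z^2
             + X^2 * Y^2 * Z + X^2 * Y * Z^2 + X * Y^2 * Z^2 + X^2 * Y^2 * Z^2) * fps_X^3
      - (X^2 * Y^2 * Z + X^2 * Y * Z^2 + X * Y^2 * Z^2 + 3 * (X^2 * Y^2 * Z^2)
         + X^3 * Y^2 * Z^2 + X^2 * Y^3 * Z^2 + X^2 * Y^2 * Z^3) * fps_X^4
      + X^3 * Y^3 * Z^3 * fps_X^6"
proof -
  have mult2: "qpow (2 * k) = qpow k ^ 2" and mult3: "qpow (3 * k) = qpow k ^ 3" for k
    using qpow_mult_nat[of k 2] qpow_mult_nat[of k 3] by (simp_all add: mult.commute)
  have const: "fps_const (u + v) = fps_const u + fps_const v"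
      "fps_const (u * v) = fps_const u * fps_const v" for u v :: laurent
    by simp_all
  have num: "fps_const (numeral n :: laurent) = numeral n" for n
    by (simp add: numeral_fps_const)
  show ?thesis
    unfolding cube_numerator_def distrib_left qpow_add mult2 mult3 const num X_def Y_def Z_def
      fps_const_power[symmetric]
    by (rule refl)
qed

lemma prod_UNIV_3: "prod f (UNIV :: 3 set) = f 1 * f 2 * f 3"
  unfolding UNIV_3 by (simp add: mult.assoc)

theorem proposition2p5:
  fixes a b c :: int
  shows "refined_ehrhart_series (vector [a, b, c] :: int ^ 3) unit_cube
           = fps_expand (cube_numerator a b c) (cube_denominator a b c)"
proof -
  have "refined_ehrhart_series (vector [a, b, c] :: int ^ 3) unit_cube
      = Abs_fps (\<lambda>r. (\<Sum>j\<le>r. qpow a ^ j) * (\<Sum>j\<le>r. qpow b ^ j) * (\<Sum>j\<le>r. qpow c ^ j))"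
    by (rule fps_ext)
      (simp only: refined_ehrhart_series_unit_cube_nth prod_UNIV_3 vector_3 fps_nth_Abs_fps)
  then have "refined_ehrhart_series (vector [a, b, c] :: int ^ 3) unit_cube
      * cube_denominator a b c = cube_numerator a b c"
    by (simp only: cube_denominator_eq cube_numerator_eq geometric_product_series_3)
  then show ?thesis
    by (simp only: fps_expand_iff[OF cube_denominator_nth_0])
qed

end
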